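(* Let $p$ be a prime number and let $n, k$ be positive integers with $k \ge n+1$. Let $x_1, \ldots, x_k \in \mathbb{Q}$ be such that the set $\{x_i \mid 1 \le i \le k\}$ has cardinality at least $n+1$, and let $y_1, \ldots, y_k \in \mathbb{Q}$. Suppose that, for all $i,j$, $y_i \neq y_j$ implies $x_i \neq x_j$. Let $P(x) \in \mathbb{Q}[x]$ be a polynomial of degree at most $n$ that minimises $\sum_{i=1}^k |P(x_i) - y_i|_p$ amongst all polynomials in $\mathbb{Q}[x]$ of degree at most $n$. Then there are at least $n+1$ values of the index $i$ for which $P(x_i) = y_i$.
   Context: $|\cdot|_p$ is the $p$-adic absolute value on $\mathbb{Q}$: $|0|_p = 0$ and $|x|_p = p^{-v_p(x)}$ for $x \ne 0$, where $v_p$ is the $p$-adic valuation. The zero polynomial counts as having degree at most $n$. *)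

theory Defs
  imports Complex_Main "HOL-Computational_Algebra.Computational_Algebra"
begin

text \<open>
  The valuation is computed from the reduced fraction representing \<open>x\<close>. Its value at \<open>0\<close>
  (here \<open>0\<close> instead of infinity) is irrelevant, since \<open>padic_abs\<close> treats \<open>0\<close> separately.
\<close>

definition padic_val :: "nat \<Rightarrow> rat \<Rightarrow> int" where
  "padic_val p x =
     int (multiplicity (int p) (fst (quotient_of x)))
       - int (multiplicity (int p) (snd (quotient_of x)))"

definition padic_abs :: "nat \<Rightarrow> rat \<Rightarrow> real" where
  "padic_abs p x = (if x = 0 then 0 else real p powi (- padic_val p x))"

end

(* If the set Z of interpolated indices had at most n elements, then g = \<Prod>i\<in>Z. (X - x i) would have
   degree at most n, vanish at the nodes of Z and at no other node. Put r i = P (x i) - y i and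
   choose j outside Z minimising |r i| / |g (x i)|. With t = - r j / g (x j) we get
   |t g (x i)| \<le> |r i| for all i outside Z, so by the ultrametric inequality P + t g is nowhere worse
   than P, and it is strictly better at j. *)
theory Submission
  imports Defs
begin

lemma rat_fraction_cases:
  fixes x :: rat
  obtains a b where "x = of_int a / of_int b" "b > 0"
  using quotient_of_div quotient_of_denom_pos by (metis prod.collapse)

text \<open>Cross-multiplying with the reduced fraction gives \<open>a * d = c * b\<close>, and
  multiplicities of a prime add over products. Hence the valuation may be read off any fraction, so
  sums and products need not be reduced to lowest terms.\<close>

lemma padic_val_fraction:
  assumes p: "prime p" and "a \<noteq> 0" "b \<noteq> 0"
  shows "padic_val p (of_int a / of_int b) =
    int (multiplicity (int p) a) - int (multiplicity (int p) b)"
proof -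
  define x :: rat where "x = of_int a / of_int b"
  obtain c d where q: "quotient_of x = (c, d)" by fastforce
  have d: "d > 0" and x: "x = of_int c / of_int d"
    using quotient_of_denom_pos[OF q] quotient_of_div[OF q] by auto
  have c: "c \<noteq> 0" using x assms unfolding x_def by auto
  have "of_int (a * d) = (of_int (c * b) :: rat)"
    using x d assms unfolding x_def by (simp add: field_simps)
  then have "a * d = c * b" by (simp only: of_int_eq_iff)
  then have "multiplicity (int p) (a * d) = multiplicity (int p) (c * b)" by simp
  moreover have "prime_elem (int p)" using p by simp
  ultimately have "multiplicity (int p) a + multiplicity (int p) d =
      multiplicity (int p) c + multiplicity (int p) b"
    using assms c d by (simp add: prime_elem_multiplicity_mult_distrib)
  then show ?thesis using q unfolding padic_val_def x_def by simp
qed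

lemma padic_val_mult:
  assumes p: "prime p" and "x \<noteq> 0" "y \<noteq> 0"
  shows "padic_val p (x * y) = padic_val p x + padic_val p y"
proof -
  obtain a b c d where *: "x = of_int a / of_int b" "b > 0" "y = of_int c / of_int d" "d > 0"
    by (metis rat_fraction_cases)
  have nz: "a \<noteq> 0" "c \<noteq> 0" using * assms by auto
  have "x * y = of_int (a * c) / of_int (b * d)" using * by simp
  moreover have "prime_elem (int p)" using p by simp
  ultimately show ?thesis
    using * nz padic_val_fraction[OF p, of "a * c" "b * d"] padic_val_fraction[OF p]
    by (simp add: prime_elem_multiplicity_mult_distrib)
qed

text \<open>Over the common denominator \<open>b * d\<close> the claim concerns only integer
  numerators: the smaller of the two powers of \<open>p\<close> divides both, hence their
  sum.\<close>

lemma padic_val_add: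
  assumes p: "prime p" and "x \<noteq> 0" "y \<noteq> 0" "x + y \<noteq> 0"
  shows "padic_val p (x + y) \<ge> min (padic_val p x) (padic_val p y)"
proof -
  obtain a b c d where *: "x = of_int a / of_int b" "b > 0" "y = of_int c / of_int d" "d > 0"
    by (metis rat_fraction_cases)
  have eqs: "x = of_int (a * d) / of_int (b * d)" "y = of_int (c * b) / of_int (b * d)"
    "x + y = of_int (a * d + c * b) / of_int (b * d)"
    using * by (simp_all add: field_simps)
  have nz: "a * d \<noteq> 0" "c * b \<noteq> 0" "a * d + c * b \<noteq> 0" "b * d \<noteq> 0"
    using eqs assms * by (fastforce, fastforce, force, simp)
  let ?m = "min (multiplicity (int p) (a * d)) (multiplicity (int p) (c * b))"
  have "int p ^ ?m dvd a * d + c * b" by (intro dvd_add multiplicity_dvd') auto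
  \<comment> \<open>Here \<open>x + y \<noteq> 0\<close> matters, since \<open>multiplicity\<close>
    takes the default value 0 at 0.\<close>
  then have "?m \<le> multiplicity (int p) (a * d + c * b)"
    using nz p by (intro multiplicity_geI) auto
  moreover have
    "padic_val p x = int (multiplicity (int p) (a * d)) - int (multiplicity (int p) (b * d))"
    "padic_val p y = int (multiplicity (int p) (c * b)) - int (multiplicity (int p) (b * d))"
    "padic_val p (x + y) =
      int (multiplicity (int p) (a * d + c * b)) - int (multiplicity (int p) (b * d))"
    using padic_val_fraction[OF p nz(1,4), folded eqs(1)]
      padic_val_fraction[OF p nz(2,4), folded eqs(2)]
      padic_val_fraction[OF p nz(3,4), folded eqs(3)] by auto
  ultimately show ?thesis by linarith
qed

lemma padic_abs_nonneg: "padic_abs p x \<ge> 0"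
  by (simp add: padic_abs_def)

lemma padic_abs_pos: "prime p \<Longrightarrow> x \<noteq> 0 \<Longrightarrow> padic_abs p x > 0"
  by (simp add: padic_abs_def prime_gt_0_nat)

lemma padic_abs_mult:
  assumes "prime p"
  shows "padic_abs p (x * y) = padic_abs p x * padic_abs p y"
  using assms prime_gt_0_nat[OF assms]
  by (simp add: padic_abs_def padic_val_mult power_int_add flip: power_int_add)

lemma padic_abs_minus:
  assumes "prime p"
  shows "padic_abs p (- x) = padic_abs p x"
proof -
  \<comment> \<open>Written as -1/1, numerator and denominator are both units, so the valuation is
    0.\<close>
  have "padic_abs p (-1) = 1"
    using padic_val_fraction[OF assms, of "-1" 1] by (simp add: padic_abs_def)
  then show ?thesis using padic_abs_mult[OF assms, of "-1" x] by simp
qed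

lemma padic_abs_add:
  assumes p: "prime p"
  shows "padic_abs p (x + y) \<le> max (padic_abs p x) (padic_abs p y)"
proof (cases "x = 0 \<or> y = 0 \<or> x + y = 0")
  case True
  then show ?thesis using padic_abs_nonneg[of p] by (auto simp: padic_abs_def max_def)
next
  case False
  then have "padic_val p (x + y) \<ge> padic_val p x \<or> padic_val p (x + y) \<ge> padic_val p y"
    using padic_val_add[OF p, of x y] by auto
  \<comment> \<open>With base at least 1, negating the exponent turns the lower bound on the
    valuation into an upper bound on the absolute value.\<close>
  moreover have "real p \<ge> 1" using prime_ge_1_nat[OF p] by simp
  ultimately show ?thesis
    using False by (auto simp: padic_abs_def le_max_iff_disj intro!: power_int_increasing)
qed

theorem corollary3:
  fixes p n k :: nat
    and x y :: "nat \<Rightarrow> rat"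
    and P :: "rat poly"
  assumes "prime p"
    and "n \<ge> 1" and "k \<ge> 1" and "k \<ge> n + 1"
    and "card (x ` {1..k}) \<ge> n + 1"
    and "\<forall>i\<in>{1..k}. \<forall>j\<in>{1..k}. y i \<noteq> y j \<longrightarrow> x i \<noteq> x j"
    and "degree P \<le> n"
    and "\<forall>Q :: rat poly. degree Q \<le> n \<longrightarrow>
           (\<Sum>i=1..k. padic_abs p (poly P (x i) - y i))
             \<le> (\<Sum>i=1..k. padic_abs p (poly Q (x i) - y i))"
  shows "card {i \<in> {1..k}. poly P (x i) = y i} \<ge> n + 1"
proof (rule ccontr)
  define Z where "Z = {i \<in> {1..k}. poly P (x i) = y i}"
  define r where "r = (\<lambda>i. poly P (x i) - y i)"
  define g where "g = (\<Prod>i\<in>Z. [:- x i, 1:])"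
  assume "\<not> card {i \<in> {1..k}. poly P (x i) = y i} \<ge> n + 1"
  then have cardZ: "card Z \<le> n" by (simp add: Z_def)
  have finZ: "finite Z" by (simp add: Z_def)
  \<comment> \<open>Each factor is linear, so the sum is \<open>card Z\<close>; for empty
    \<open>Z\<close> the product is the constant 1.\<close>
  have "degree g \<le> (\<Sum>i\<in>Z. degree [:- x i, 1:])"
    using finZ degree_prod_sum_le[of Z "\<lambda>i. [:- x i, 1:]"] by (simp add: g_def o_def)
  then have deg_g: "degree g \<le> n" using cardZ by simp
  have g_Z: "poly g (x i) = 0" if "i \<in> Z" for i
    using that finZ by (auto simp: g_def poly_prod)
  have g_nz: "poly g (x i) \<noteq> 0" if i: "i \<in> {1..k} - Z" for i
  proof
    assume "poly g (x i) = 0"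
    then obtain j where "j \<in> Z" "x i = x j" using finZ by (auto simp: g_def poly_prod)
    \<comment> \<open>Equal nodes carry equal data, so \<open>y i = y j\<close>. Then
      \<open>P\<close> also interpolates at \<open>i\<close>, which puts \<open>i\<close> in
      \<open>Z\<close>.\<close>
    then show False using i assms(6) by (force simp: Z_def)
  qed
  have r_nz: "r i \<noteq> 0" if "i \<in> {1..k} - Z" for i using that by (auto simp: Z_def r_def)
  have "{1..k} - Z \<noteq> {}"
  proof
    assume "{1..k} - Z = {}"
    then have "card {1..k} \<le> card Z" using finZ by (intro card_mono) auto
    then show False using cardZ assms(4) by simp
  qed
  define ratio where "ratio = (\<lambda>i. padic_abs p (r i) / padic_abs p (poly g (x i)))"
  define j where "j = arg_min_on ratio ({1..k} - Z)"
  have j: "j \<in> {1..k} - Z"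
    unfolding j_def using \<open>{1..k} - Z \<noteq> {}\<close> by (intro arg_min_if_finite(1)) auto
  have j_min: "ratio j \<le> ratio i" if "i \<in> {1..k} - Z" for i
    unfolding j_def using that by (intro arg_min_least) auto
  define t where "t = - (r j / poly g (x j))"
  define Q where "Q = P + smult t g"
  have "degree Q \<le> n"
    unfolding Q_def using assms(7) deg_g degree_smult_le[of t g] by (intro degree_add_le) auto
  have res: "poly Q (x i) - y i = r i + t * poly g (x i)" for i by (simp add: Q_def r_def)
  \<comment> \<open>Multiplicativity is applied to \<open>r j / poly g (x j)\<close> times
    \<open>poly g (x j)\<close>, whose product is \<open>r j\<close>; dividing by the positive
    second factor gives the absolute value of the quotient.\<close>
  have abs_t: "padic_abs p t = ratio j"
    using padic_abs_mult[OF assms(1), of "r j / poly g (x j)" "poly g (x j)"] g_nz[OF j]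
      padic_abs_pos[OF assms(1) g_nz[OF j]]
    by (simp add: t_def ratio_def padic_abs_minus[OF assms(1)])
  have le: "padic_abs p (poly Q (x i) - y i) \<le> padic_abs p (r i)" if i: "i \<in> {1..k}" for i
  proof (cases "i \<in> Z")
    case True
    then show ?thesis by (simp add: res g_Z)
  next
    case False
    then have "padic_abs p t \<le> padic_abs p (r i) / padic_abs p (poly g (x i))"
      using j_min[of i] i abs_t by (simp add: ratio_def)
    then have "padic_abs p (t * poly g (x i)) \<le> padic_abs p (r i)"
      using padic_abs_pos[OF assms(1) g_nz[of i]] False i
      by (simp add: padic_abs_mult[OF assms(1)] field_simps)
    \<comment> \<open>Both summands of the new residual are bounded by the old one, and so is their
      maximum. The ordinary triangle inequality would only give twice that bound.\<close>
    then show ?thesis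
      using padic_abs_add[OF assms(1), of "r i" "t * poly g (x i)"] by (simp add: res)
  qed
  \<comment> \<open>The sign of \<open>t\<close> makes the correction cancel \<open>r j\<close>
    exactly, while \<open>r j\<close> itself is nonzero because \<open>j\<close> lies outside
    \<open>Z\<close>.\<close>
  have "poly Q (x j) - y j = 0" using g_nz[OF j] by (simp add: res t_def)
  then have "padic_abs p (poly Q (x j) - y j) < padic_abs p (r j)"
    using padic_abs_pos[OF assms(1) r_nz[OF j]] by (simp add: padic_abs_def)
  then have "(\<Sum>i=1..k. padic_abs p (poly Q (x i) - y i)) < (\<Sum>i=1..k. padic_abs p (r i))"
    using le j by (intro sum_strict_mono_ex1) auto
  then show False using assms(8) \<open>degree Q \<le> n\<close> unfolding r_def by (simp add: not_le[symmetric])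
qed

end
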